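(* Let $n\ge 1$, $N=\{1,\dots,n\}$, $\sigma\ge 0$, $a_i>0$ for $i\in N$, and $$F=\Big\{(x,y,z)\in\{0,1\}^N\times\mathbb{R}_+^N\times\mathbb{R}_+ :\ \sigma+\sum_{i\in N}a_iy_i^2\le z^2,\ \mathbf{0}\le y\le x\Big\}.$$ Let $((1),(2),\dots,(n))$ be any permutation of $N$, put $\sigma_{(0)}=\sigma$ and $\sigma_{(i)}=a_{(i)}+\sigma_{(i-1)}$ for $i=1,\dots,n$, and define $\pi,\alpha\in\mathbb{R}^N$ by $$\pi_{(i)}=\sqrt{\sigma_{(i)}}-\sqrt{\sigma_{(i-1)}},\qquad \alpha_{(i)}=\frac{a_{(i)}}{\sqrt{\sigma_{(i)}}},\qquad i=1,\dots,n.$$ Then the inequality $$\pi'x\le z+\alpha'(x-y)-\sqrt{\sigma}$$ is valid for $F$, i.e. it holds for every $(x,y,z)\in F$.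
   Context: $\mathbf{0}$ is the vector of zeros, $'$ denotes transpose, and vector inequalities are componentwise. *)

theory Defs
  imports "HOL-Analysis.Analysis"
begin

text \<open>Vectors over \<open>N = {1..n}\<close> are extensional functions, i.e. elements of
  \<open>{1..n} \<rightarrow>\<^sub>E S\<close>, because the permuted partial sums below need an ordered index set.\<close>

definition mixed_conic_set ::
  "nat \<Rightarrow> real \<Rightarrow> (nat \<Rightarrow> real) \<Rightarrow> ((nat \<Rightarrow> real) \<times> (nat \<Rightarrow> real) \<times> real) set" where
  "mixed_conic_set n \<sigma> a =
    {(x, y, z). x \<in> {1..n} \<rightarrow>\<^sub>E {0, 1} \<and> y \<in> {1..n} \<rightarrow>\<^sub>E {0..} \<and> z \<ge> 0 \<and>
       \<sigma> + (\<Sum>i\<in>{1..n}. a i * (y i)\<^sup>2) \<le> z\<^sup>2 \<and>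
       (\<forall>i\<in>{1..n}. 0 \<le> y i \<and> y i \<le> x i)}"

text \<open>The argument \<open>p\<close> encodes the permutation \<open>((1), \<dots>, (n))\<close> by \<open>p i = (i)\<close>.\<close>

primrec perm_sigma :: "real \<Rightarrow> (nat \<Rightarrow> real) \<Rightarrow> (nat \<Rightarrow> nat) \<Rightarrow> nat \<Rightarrow> real" where
  "perm_sigma \<sigma> a p 0 = \<sigma>"
| "perm_sigma \<sigma> a p (Suc i) = a (p (Suc i)) + perm_sigma \<sigma> a p i"

end

theory Submission
  imports Defs
begin

text \<open>Bring in the indices one at a time, in the order given by the permutation, and compare two
  partial sums of \<open>\<sigma> + (\<Sum>i. a i * (y i)\<^sup>2)\<close>: \<open>S\<close>, in which every \<open>y\<close> is replaced by \<open>1\<close>, and \<open>t \<le> S\<close>, in which the actual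
  \<open>y\<close> are used. If \<open>x = 0\<close> at the next index, then \<open>y = 0\<close> there and neither side of the inequality
  moves. If \<open>x = 1\<close>, the left-hand side minus the \<open>\<alpha>\<close>-term grows by
  \<open>sqrt (S + a) - sqrt S - a * (1 - y) / sqrt (S + a)\<close>. By Cauchy--Schwarz for the vectors
  \<open>(sqrt S, sqrt a)\<close> and \<open>(sqrt S, sqrt a * y)\<close> this is at most \<open>sqrt (S + a * y\<^sup>2) - sqrt S\<close>,
  and as the square root is concave the latter is at most \<open>sqrt (t + a * y\<^sup>2) - sqrt t\<close>. Summing these
  increments telescopes to the square root of \<open>\<sigma> + (\<Sum>i. a i * (y i)\<^sup>2)\<close>, which is at most \<open>z\<close>.\<close>

lemma sqrt_increment_antimono:
  fixes s t d :: real
  assumes "0 \<le> t" "t \<le> s" "0 \<le> d"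
  shows "sqrt (s + d) - sqrt s \<le> sqrt (t + d) - sqrt t"
proof (rule ccontr)
  assume "\<not> ?thesis"
  then have lt: "sqrt (t + d) + sqrt s < sqrt (s + d) + sqrt t" by simp
  \<comment> \<open>Both sides have squares with the same non-root part \<open>s + t + d\<close>, so only the products of the
    roots have to be compared.\<close>
  have "(sqrt (t + d) + sqrt s)\<^sup>2 < (sqrt (s + d) + sqrt t)\<^sup>2"
    using lt assms by (intro power_strict_mono) auto
  then have "sqrt ((t + d) * s) < sqrt ((s + d) * t)"
    using assms by (simp add: power2_sum real_sqrt_mult)
  then have "d * s < d * t" by (simp add: algebra_simps)
  moreover have "d * t \<le> d * s" using assms by (intro mult_left_mono)
  ultimately show False by simp
qed

text \<open>The tangent of the convex function \<open>y \<mapsto> sqrt (s + a * y\<^sup>2)\<close> at \<open>y = 1\<close> lies below it;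
  clearing the root, this is Cauchy--Schwarz.\<close>

lemma sqrt_quadratic_ge_tangent_at_1:
  fixes s a y :: real
  assumes "0 \<le> s" "0 < a"
  shows "sqrt (s + a) - a / sqrt (s + a) * (1 - y) \<le> sqrt (s + a * y\<^sup>2)"
proof -
  have pos: "0 < sqrt (s + a)" using assms by simp
  have "(s + a) * (s + a * y\<^sup>2) - (s + a * y)\<^sup>2 = s * a * (1 - y)\<^sup>2"
    by (simp add: power2_eq_square algebra_simps)
  moreover have "0 \<le> s * a * (1 - y)\<^sup>2" using assms by simp
  ultimately have "(s + a * y)\<^sup>2 \<le> (s + a) * (s + a * y\<^sup>2)" by linarith
  then have "s + a * y \<le> sqrt (s + a) * sqrt (s + a * y\<^sup>2)"
    by (metis real_le_rsqrt real_sqrt_mult)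
  then have "(s + a * y) / sqrt (s + a) \<le> sqrt (s + a * y\<^sup>2)"
    using pos by (simp add: field_simps)
  moreover have "sqrt (s + a) - a / sqrt (s + a) * (1 - y) = (s + a * y) / sqrt (s + a)"
    using pos assms by (simp add: field_simps)
  ultimately show ?thesis by simp
qed

lemma sqrt_increment_bound:
  fixes s t a x y :: real
  assumes "0 \<le> t" "t \<le> s" "0 < a" "x \<in> {0, 1}" "0 \<le> y" "y \<le> x"
  shows "(sqrt (s + a) - sqrt s) * x - a / sqrt (s + a) * (x - y) \<le> sqrt (t + a * y\<^sup>2) - sqrt t"
proof (cases "x = 0")
  case True
  then show ?thesis using assms by simp
next
  case False
  then have "x = 1" using assms by simp
  moreover have "sqrt (s + a) - a / sqrt (s + a) * (1 - y) \<le> sqrt (s + a * y\<^sup>2)"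
    using assms by (intro sqrt_quadratic_ge_tangent_at_1) auto
  moreover have "sqrt (s + a * y\<^sup>2) - sqrt s \<le> sqrt (t + a * y\<^sup>2) - sqrt t"
    using assms by (intro sqrt_increment_antimono) auto
  ultimately show ?thesis by simp
qed

lemma perm_sigma_eq_sum: "perm_sigma \<sigma> a p k = \<sigma> + (\<Sum>i\<in>{1..k}. a (p i))"
  by (induction k) auto

theorem proposition6:
  fixes n :: nat and \<sigma> :: real and a \<pi> \<alpha> :: "nat \<Rightarrow> real" and p :: "nat \<Rightarrow> nat"
  assumes "n \<ge> 1"
    and "\<sigma> \<ge> 0"
    and "\<forall>i\<in>{1..n}. a i > 0"
    and "p permutes {1..n}"
    and "\<forall>i\<in>{1..n}. \<pi> (p i) = sqrt (perm_sigma \<sigma> a p i) - sqrt (perm_sigma \<sigma> a p (i - 1))"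
    and "\<forall>i\<in>{1..n}. \<alpha> (p i) = a (p i) / sqrt (perm_sigma \<sigma> a p i)"
  shows "\<forall>(x, y, z) \<in> mixed_conic_set n \<sigma> a.
           (\<Sum>i\<in>{1..n}. \<pi> i * x i) \<le> z + (\<Sum>i\<in>{1..n}. \<alpha> i * (x i - y i)) - sqrt \<sigma>"
proof clarify
  fix x y :: "nat \<Rightarrow> real" and z :: real
  assume F: "(x, y, z) \<in> mixed_conic_set n \<sigma> a"
  have x01: "x i \<in> {0, 1}" and y0: "0 \<le> y i" and yx: "y i \<le> x i" if "i \<in> {1..n}" for i
    using F that unfolding mixed_conic_set_def by (auto dest: PiE_mem)
  have z0: "0 \<le> z" and conic: "\<sigma> + (\<Sum>i\<in>{1..n}. a i * (y i)\<^sup>2) \<le> z\<^sup>2"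
    using F unfolding mixed_conic_set_def by auto
  define b where "b i = a i * (y i)\<^sup>2" for i
  define g where "g i = \<pi> i * x i - \<alpha> i * (x i - y i)" for i
  have p_mem: "p i \<in> {1..n}" if "i \<in> {1..n}" for i
    using permutes_in_image[OF assms(4)] that by blast
  have b_bounds: "0 \<le> b (p i)" "b (p i) \<le> a (p i)" if "i \<in> {1..n}" for i
  proof -
    have "0 < a (p i)" "0 \<le> y (p i)" "y (p i) \<le> 1"
      using assms(3) x01[of "p i"] y0[of "p i"] yx[of "p i"] p_mem[OF that] by auto
    then show "0 \<le> b (p i)" "b (p i) \<le> a (p i)"
      unfolding b_def by (auto simp: mult_left_le power_le_one)
  qed
  have reindex: "(\<Sum>i\<in>{1..n}. f (p i)) = (\<Sum>i\<in>{1..n}. f i)" for f :: "nat \<Rightarrow> real"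
    using sum.reindex_bij_betw[OF permutes_imp_bij[OF assms(4)]] .
  have "sqrt \<sigma> + (\<Sum>i\<in>{1..k}. g (p i)) \<le> sqrt (perm_sigma \<sigma> b p k)" if "k \<le> n" for k
    using that
  proof (induction k)
    case 0
    then show ?case by simp
  next
    case (Suc k)
    have mem: "Suc k \<in> {1..n}" using Suc.prems by simp
    let ?j = "p (Suc k)" and ?s = "perm_sigma \<sigma> a p k" and ?t = "perm_sigma \<sigma> b p k"
    have "0 \<le> ?t"
      unfolding perm_sigma_eq_sum using assms(2) b_bounds(1) Suc.prems
      by (intro add_nonneg_nonneg sum_nonneg) auto
    moreover have "?t \<le> ?s"
      unfolding perm_sigma_eq_sum using b_bounds(2) Suc.prems
      by (intro add_left_mono sum_mono) auto
    ultimately have "(sqrt (?s + a ?j) - sqrt ?s) * x ?j - a ?j / sqrt (?s + a ?j) * (x ?j - y ?j)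
        \<le> sqrt (?t + a ?j * (y ?j)\<^sup>2) - sqrt ?t"
      using assms(3) x01 y0 yx p_mem[OF mem] by (intro sqrt_increment_bound) blast+
    then have "g ?j \<le> sqrt (perm_sigma \<sigma> b p (Suc k)) - sqrt ?t"
      unfolding g_def using assms(5,6) mem by (simp add: b_def add.commute)
    then show ?case using Suc by simp
  qed
  from this[of n] have "sqrt \<sigma> + (\<Sum>i\<in>{1..n}. g i) \<le> sqrt (\<sigma> + (\<Sum>i\<in>{1..n}. b i))"
    by (simp only: perm_sigma_eq_sum reindex order.refl)
  also have "\<dots> \<le> z"
    using conic z0 unfolding b_def by (rule real_le_lsqrt[rotated])
  finally show "(\<Sum>i\<in>{1..n}. \<pi> i * x i)
      \<le> z + (\<Sum>i\<in>{1..n}. \<alpha> i * (x i - y i)) - sqrt \<sigma>"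
    by (simp add: g_def sum_subtractf)
qed

end
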